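(* There exist a continuous map $\psi\colon\omega^\omega\to[\omega]^\omega$ and a Borel map $\phi\colon[\omega]^\omega\to\omega^\omega$ such that: (a) the family $\psi(\omega^\omega)=\{\psi(f):f\in\omega^\omega\}$ is centered, and (b) for all $A\in[\omega]^\omega$ and $f\in\omega^\omega$, if $A\subseteq^*\psi(f)$ then $f\leq^*\phi(A)$.
   Context: $[\omega]^\omega$ is the space of infinite subsets of $\omega$ (identified with a subspace of $2^\omega$), and $\omega^\omega$ is the Baire space. $A\subseteq^* B$ means $A\setminus B$ is finite. For $f,g\in\omega^\omega$, $f\leq^* g$ means $f(n)\leq g(n)$ for all but finitely many $n$. A family $\mathcal F\subseteq[\omega]^\omega$ is centered if every finite subfamily has infinite intersection. *)

theory Defs
  imports "HOL-Analysis.Analysis"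
begin

text \<open>The space of infinite subsets of \<open>nat\<close>. A set is identified with its characteristic function
  in \<open>nat \<Rightarrow> bool\<close>, which carries the product of the discrete topologies (type class instance), so
  this is the topology for which that identification is an embedding into the Cantor space.\<close>

definition inf_sets_topology :: "nat set topology" where
  "inf_sets_topology =
     pullback_topology {A. infinite A} (\<lambda>A n. n \<in> A) (euclidean :: (nat \<Rightarrow> bool) topology)"

definition borel_of_topology :: "'a topology \<Rightarrow> 'a measure" where
  "borel_of_topology X = sigma (topspace X) {U. openin X U}"

definition almost_subset :: "nat set \<Rightarrow> nat set \<Rightarrow> bool"  (infix \<open>\<subseteq>\<^sup>*\<close> 50) where
  "A \<subseteq>\<^sup>* B \<longleftrightarrow> finite (A - B)"

definition almost_le :: "(nat \<Rightarrow> nat) \<Rightarrow> (nat \<Rightarrow> nat) \<Rightarrow> bool"  (infix \<open>\<le>\<^sup>*\<close> 50) where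
  "f \<le>\<^sup>* g \<longleftrightarrow> (\<forall>\<^sub>F n in cofinite. f n \<le> g n)"

text \<open>The empty subfamily imposes no condition: its intersection is \<open>UNIV\<close>.\<close>

definition centered :: "nat set set \<Rightarrow> bool" where
  "centered \<F> \<longleftrightarrow>
     \<F> \<subseteq> {A. infinite A} \<and> (\<forall>\<G>\<subseteq>\<F>. finite \<G> \<longrightarrow> infinite (\<Inter>\<G>))"

lemma openin_inf_sets_topology:
  "openin inf_sets_topology S \<longleftrightarrow>
     (\<exists>U. open (U :: (nat \<Rightarrow> bool) set) \<and> S = {A. infinite A \<and> (\<lambda>n. n \<in> A) \<in> U})"
  unfolding inf_sets_topology_def openin_pullback_topology
  by (auto simp: vimage_def Int_def conj_commute)

lemma topspace_inf_sets_topology: "topspace inf_sets_topology = {A. infinite A}"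
  by (simp add: inf_sets_topology_def topspace_pullback_topology)

lemma space_borel_of_topology: "space (borel_of_topology X) = topspace X"
  by (simp add: borel_of_topology_def space_measure_of_conv)

lemma sets_borel_of_topology:
  "sets (borel_of_topology X) = sigma_sets (topspace X) {U. openin X U}"
  unfolding borel_of_topology_def by (intro sets_measure_of) (auto dest: openin_subset)

end

theory Submission
  imports Defs
begin

text \<open>
  A point is a pair \<open>(b, S)\<close> with \<open>S\<close> a finite list of finite sequences; the set assigned to \<open>f\<close>
  consists of the points for which \<open>S\<close> contains the longest initial segment of \<open>f\<close> of length at
  most \<open>b\<close> with all entries below \<open>b\<close>. Finitely many functions share the points \<open>(b, S)\<close> where \<open>S\<close>
  lists their segments. Each \<open>S\<close> is required to have at most as many members as the length of
  each of them, which is harmless for large \<open>b\<close>. If now an infinite \<open>A\<close> is almost contained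
  in the set of \<open>f\<close>, this Schreier-type condition lets only finitely many initial segments \<open>s\<close>
  of \<open>f\<close> belong to \<open>S\<close> for almost all \<open>(b, S) \<in> A\<close>. For every other segment \<open>s\<close> of length \<open>n\<close>, some
  \<open>(b, S) \<in> A\<close> with large \<open>b\<close> has \<open>s \<notin> S\<close>, and then \<open>f n < b\<close>, as otherwise \<open>s\<close> would be
  the segment required in \<open>S\<close>. Thus \<open>f n\<close> is eventually bounded in terms of \<open>A\<close> and the previous
  values of \<open>f\<close>, and iterating this bound dominates \<open>f\<close>.
\<close>

section \<open>A centered family of sets of points\<close>

definition bounded_segment :: "nat \<Rightarrow> (nat \<Rightarrow> nat) \<Rightarrow> nat list" where
  "bounded_segment b f = takeWhile (\<lambda>x. x < b) (map f [0..<b])"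

text \<open>The bounds by \<open>b\<close> leave only finitely many \<open>S\<close> for each
  \<open>b\<close>, so an infinite subset has points with arbitrarily large \<open>b\<close>.
  Membership of \<open>(b, S)\<close> depends only on the first \<open>b\<close> values of
  \<open>f\<close>, whence continuity.\<close>

definition segment_points :: "(nat \<Rightarrow> nat) \<Rightarrow> (nat \<times> nat list list) set" where
  "segment_points f = {(b, S). bounded_segment b f \<in> set S \<and>
     (\<forall>s\<in>set S. length S \<le> length s \<and> length s \<le> b \<and> set s \<subseteq> {..<b})}"

lemma length_bounded_segment_le: "length (bounded_segment b f) \<le> b"
  unfolding bounded_segment_def by (metis length_takeWhile_le length_map length_upt diff_zero)

lemma set_bounded_segment: "set (bounded_segment b f) \<subseteq> {..<b}"
  unfolding bounded_segment_def by (auto dest: set_takeWhileD)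

lemma bounded_segment_eq:
  assumes "n < b" "\<forall>i<n. f i < b" "b \<le> f n"
  shows "bounded_segment b f = map f [0..<n]"
proof -
  have "bounded_segment b f = take n (map f [0..<b])"
    unfolding bounded_segment_def
    by (rule takeWhile_eq_take_P_nth) (use assms in auto)
  then show ?thesis
    using assms by (simp add: take_map)
qed

lemma length_bounded_segment_ge:
  assumes "k \<le> b" "\<forall>i<k. f i < b"
  shows "k \<le> length (bounded_segment b f)"
proof (rule ccontr)
  let ?n = "length (bounded_segment b f)"
  assume "\<not> ?thesis"
  then have n: "?n < k" by simp
  then have "\<not> map f [0..<b] ! ?n < b"
    unfolding bounded_segment_def using assms(1)
    by (intro nth_length_takeWhile) simp
  with n assms show False by simp
qed

lemma infinite_Inter_segment_points:
  assumes "finite F"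
  shows "infinite (\<Inter>f\<in>F. segment_points f)"
proof -
  obtain fs where fs: "set fs = F"
    using finite_list[OF assms] by blast
  let ?k = "length fs"
  \<comment> \<open>From \<open>b0\<close> on, each of the \<open>?k\<close> segments has length at
    least \<open>?k\<close>, the length of the list formed from them.\<close>
  define b0 where "b0 = ?k + (\<Sum>f\<in>F. \<Sum>i<?k. Suc (f i))"
  have below: "f i < b0" if "f \<in> F" "i < ?k" for f i
  proof -
    have "Suc (f i) \<le> (\<Sum>i<?k. Suc (f i))"
      using that by (intro member_le_sum) auto
    also have "\<dots> \<le> (\<Sum>f\<in>F. \<Sum>i<?k. Suc (f i))"
      using that assms by (intro member_le_sum[where f = "\<lambda>f. \<Sum>i<?k. Suc (f i)"]) auto
    finally show ?thesis by (simp add: b0_def)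
  qed
  let ?p = "\<lambda>b. (b, map (bounded_segment b) fs)"
  have "?p b \<in> segment_points f" if "b0 \<le> b" "f \<in> F" for b f
  proof -
    have "?k \<le> length (bounded_segment b g)" if "g \<in> F" for g
      using below[OF that] \<open>b0 \<le> b\<close>
      by (intro length_bounded_segment_ge) (auto simp: b0_def intro: less_le_trans)
    then show ?thesis
      using that fs length_bounded_segment_le set_bounded_segment
      by (auto simp: segment_points_def)
  qed
  then have "?p ` {b0..} \<subseteq> (\<Inter>f\<in>F. segment_points f)"
    by auto
  moreover have "infinite (?p ` {b0..})"
    by (subst finite_image_iff) (auto simp: inj_on_def infinite_Ici)
  ultimately show ?thesis
    using finite_subset by blast
qed

section \<open>Bounding the next value of a function from an almost-subset\<close>

lemma finite_segment_points_le: "finite {x \<in> segment_points f. fst x \<le> c}"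
proof -
  let ?X = "{s. set s \<subseteq> {..<c} \<and> length s \<le> c}"
  have "finite ({..c} \<times> {S. set S \<subseteq> ?X \<and> length S \<le> c})"
    by (intro finite_cartesian_product finite_lists_length_le) auto
  moreover have "{x \<in> segment_points f. fst x \<le> c} \<subseteq> {..c} \<times> {S. set S \<subseteq> ?X \<and> length S \<le> c}"
    by (fastforce simp: segment_points_def)
  ultimately show ?thesis
    by (rule finite_subset[rotated])
qed

text \<open>Otherwise, for some \<open>n\<close>, a single point of the set of \<open>f\<close>
  would list \<open>n + 1\<close> distinct segments along with the one of length \<open>n\<close>,
  whose presence caps the list at \<open>n\<close> members.\<close>

lemma finite_eventually_listed_segments:
  assumes inf: "infinite A" and sub: "finite (A - segment_points f)"
  shows "finite {n. finite {x \<in> A. map f [0..<n] \<notin> set (snd x)}}" (is "finite ?L")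
proof (rule ccontr)
  assume L: "infinite ?L"
  then obtain n where n: "n \<in> ?L"
    using infinite_imp_nonempty by blast
  obtain K where K: "K \<subseteq> ?L" "finite K" "card K = Suc n"
    using infinite_arbitrarily_large[OF L] by blast
  let ?bad = "(\<Union>m\<in>insert n K. {x \<in> A. map f [0..<m] \<notin> set (snd x)})"
  have "finite ((A - segment_points f) \<union> ?bad)"
    using K n sub by blast
  then obtain x where x: "x \<in> A" "x \<notin> (A - segment_points f) \<union> ?bad"
    using inf by (meson finite_subset subsetI)
  then have mem: "map f [0..<m] \<in> set (snd x)" if "m \<in> insert n K" for m
    using that by blast
  have "Suc n = card ((\<lambda>m. map f [0..<m]) ` K)"
    using K(3) by (subst card_image) (auto simp: inj_on_def dest: map_eq_imp_length_eq)
  also have "\<dots> \<le> card (set (snd x))"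
    using mem by (intro card_mono) auto
  also have "\<dots> \<le> length (snd x)"
    by (rule card_length)
  also have "\<dots> \<le> length (map f [0..<n])"
    using x mem[of n] by (auto simp: segment_points_def simp del: length_map)
  finally show False by simp
qed

text \<open>When no pair qualifies, \<^const>\<open>Least\<close> returns an unspecified value that does not depend on \<open>A\<close>
  or \<open>s\<close>; this happens for only finitely many of the segments that matter.\<close>

definition omission_bound :: "(nat \<times> nat list list) set \<Rightarrow> nat list \<Rightarrow> nat" where
  "omission_bound A s =
     (LEAST b. \<exists>S. (b, S) \<in> A \<and> s \<notin> set S \<and> length s < b \<and> set s \<subseteq> {..<b})"

lemma eventually_less_omission_bound:
  assumes inf: "infinite A" and sub: "finite (A - segment_points f)"
  shows "\<forall>\<^sub>F n in sequentially. f n < omission_bound A (map f [0..<n])"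
proof -
  let ?E = "A - segment_points f"
  obtain N where N: "\<And>x. x \<in> ?E \<Longrightarrow> fst x \<le> N"
    using finite_nat_set_iff_bounded_le[of "fst ` ?E"] sub by auto
  have less: "f n < omission_bound A (map f [0..<n])"
    if n: "infinite {x \<in> A. map f [0..<n] \<notin> set (snd x)}" "N \<le> n" for n
  proof -
    let ?s = "map f [0..<n]"
    let ?P = "\<lambda>b. \<exists>S. (b, S) \<in> A \<and> ?s \<notin> set S \<and> length ?s < b \<and> set ?s \<subseteq> {..<b}"
    \<comment> \<open>A point with first coordinate above \<open>c\<close> exceeds \<open>n\<close>
      and all earlier values of \<open>f\<close>, so it qualifies for the
      \<open>LEAST\<close>.\<close>
    define c where "c = n + (\<Sum>i<n. f i)"
    have "finite (?E \<union> {x \<in> segment_points f. fst x \<le> c})"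
      using sub finite_segment_points_le by blast
    then obtain x where x: "x \<in> A" "?s \<notin> set (snd x)"
        "x \<notin> ?E \<union> {x \<in> segment_points f. fst x \<le> c}"
      using n(1) by (metis (no_types, lifting) finite_subset mem_Collect_eq subsetI)
    have "f i \<le> (\<Sum>i<n. f i)" if "i < n" for i
      using that by (intro member_le_sum) auto
    then have "?P (fst x)"
      using x by (intro exI[of _ "snd x"]) (fastforce simp: c_def)
    then have "?P (omission_bound A ?s)"
      unfolding omission_bound_def by (rule LeastI)
    then obtain b S where b: "b = omission_bound A ?s" "(b, S) \<in> A" "?s \<notin> set S"
        "n < b" "\<forall>i<n. f i < b"
      by fastforce
    \<comment> \<open>The minimal \<open>b\<close> need not come from \<open>x\<close>. Its point
      still lies in the set of \<open>f\<close>, because \<open>b > n \<ge> N\<close> and the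
      exceptions have first coordinate at most \<open>N\<close>.\<close>
    then have "(b, S) \<in> segment_points f"
      using N[of "(b, S)"] n(2) by auto
    with b have "bounded_segment b f \<noteq> ?s"
      by (auto simp: segment_points_def)
    with b show ?thesis
      using bounded_segment_eq[of n b f] by force
  qed
  have "\<forall>\<^sub>F n in sequentially. infinite {x \<in> A. map f [0..<n] \<notin> set (snd x)}"
    using finite_eventually_listed_segments[OF assms]
    by (simp add: eventually_cofinite flip: cofinite_eq_sequentially)
  then show ?thesis
    using eventually_ge_at_top[of N] by eventually_elim (rule less)
qed

section \<open>Domination by iterating the bound\<close>

text \<open>Summing over all candidates for the first \<open>n\<close> values covers the actual
  segment of \<open>f\<close> without reference to \<open>f\<close>.\<close>

fun iterated_bound :: "(nat list \<Rightarrow> nat) \<Rightarrow> nat \<Rightarrow> nat \<Rightarrow> nat" where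
  "iterated_bound g c 0 = c"
| "iterated_bound g c (Suc n) = iterated_bound g c n +
     (\<Sum>s | set s \<subseteq> {..iterated_bound g c n} \<and> length s = n. g s)"

lemma iterated_bound_mono:
  assumes "c \<le> d"
  shows "iterated_bound g c n \<le> iterated_bound g d n"
proof (induction n)
  case (Suc n)
  then have "(\<Sum>s | set s \<subseteq> {..iterated_bound g c n} \<and> length s = n. g s)
      \<le> (\<Sum>s | set s \<subseteq> {..iterated_bound g d n} \<and> length s = n. g s)"
    by (intro sum_mono2 finite_lists_length_eq) auto
  with Suc show ?case by simp
qed (use assms in simp)

text \<open>A start value absorbing the finitely many exceptions depends on \<open>f\<close>. Taking
  \<open>n\<close> itself as start value eventually exceeds it, so one bound serves all
  \<open>f\<close>.\<close>

lemma iterated_bound_dominates: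
  fixes f :: "nat \<Rightarrow> nat"
  assumes "\<forall>\<^sub>F n in sequentially. f n < g (map f [0..<n])"
  shows "\<forall>\<^sub>F n in sequentially. f n \<le> iterated_bound g n (Suc n)"
proof -
  obtain n0 where n0: "\<And>n. n0 \<le> n \<Longrightarrow> f n < g (map f [0..<n])"
    using assms by (auto simp: eventually_sequentially)
  define c where "c = (\<Sum>i<n0. f i)"
  have bound: "\<forall>i<n. f i \<le> iterated_bound g c n" for n
  proof (induction n)
    case (Suc n)
    have "f n \<le> iterated_bound g c (Suc n)"
    proof (cases "n < n0")
      case True
      then have "f n \<le> c"
        unfolding c_def by (intro member_le_sum) auto
      also have "c \<le> iterated_bound g c m" for m
        by (induction m) auto
      finally show ?thesis .
    next
      case False
      have "g (map f [0..<n]) \<le> (\<Sum>s | set s \<subseteq> {..iterated_bound g c n} \<and> length s = n. g s)"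
        using Suc by (intro member_le_sum finite_lists_length_eq) auto
      with n0[of n] False show ?thesis by simp
    qed
    with Suc show ?case
      by (auto simp: less_Suc_eq intro: trans_le_add1)
  qed simp
  have "f n \<le> iterated_bound g n (Suc n)" if "c \<le> n" for n
    using bound[of "Suc n"] iterated_bound_mono[OF that, of g "Suc n"] by (meson lessI le_trans)
  then show ?thesis
    by (auto simp: eventually_sequentially)
qed

section \<open>Measurability\<close>

lemma borel_measurable_eq_count_space:
  "borel_measurable M = measurable M (count_space (UNIV :: 'a :: {countable, t2_space} set))"
  by (rule measurable_cong_sets[OF refl sets_borel_eq_count_space])

lemma measurable_iterated_bound:
  assumes "\<And>s. (\<lambda>x. g x s) \<in> measurable M (count_space UNIV)"
  shows "(\<lambda>x. iterated_bound (g x) c n) \<in> measurable M (count_space UNIV)"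
proof (induction n)
  case (Suc n)
  \<comment> \<open>The index set varies with \<open>x\<close>, so the bound is first frozen at
    \<open>b\<close>; it takes only countably many values.\<close>
  have "(\<lambda>x. \<Sum>s | set s \<subseteq> {..b} \<and> length s = n. g x s) \<in> measurable M (count_space UNIV)" for b
    using borel_measurable_sum[of _ "\<lambda>s x. g x s" M] assms
    by (simp add: borel_measurable_eq_count_space)
  then have "(\<lambda>x. \<Sum>s | set s \<subseteq> {..iterated_bound (g x) c n} \<and> length s = n. g x s)
      \<in> measurable M (count_space UNIV)"
    using Suc by (rule measurable_compose_countable)
  with Suc show ?case
    using borel_measurable_add[of "\<lambda>x. iterated_bound (g x) c n" M]
    by (simp add: borel_measurable_eq_count_space)
qed simp

lemma pred_member_inf_sets:
  "Measurable.pred (borel_of_topology inf_sets_topology) (\<lambda>A. n \<in> A)"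
proof -
  have "open ((\<lambda>x. x n) -` {True} :: (nat \<Rightarrow> bool) set)"
    by (intro open_vimage continuous_on_product_coordinates open_discrete)
  then have "openin inf_sets_topology {A. infinite A \<and> n \<in> A}"
    unfolding openin_inf_sets_topology by (intro exI[of _ "(\<lambda>x. x n) -` {True}"]) auto
  then have "{A. infinite A \<and> n \<in> A} \<in> sets (borel_of_topology inf_sets_topology)"
    unfolding sets_borel_of_topology by (intro sigma_sets.Basic) simp
  then show ?thesis
    by (simp add: pred_def space_borel_of_topology topspace_inf_sets_topology)
qed

lemma measurable_omission_bound:
  "(\<lambda>A. omission_bound (to_nat -` A) s)
     \<in> measurable (borel_of_topology inf_sets_topology) (count_space UNIV)"
  unfolding omission_bound_def vimage_eq
  by (intro measurable_Least pred_intros_countable pred_intros_logic pred_member_inf_sets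
      measurable_const) simp_all

section \<open>Continuity and transfer to sets of naturals\<close>

lemma open_Collect_initial_segment:
  "open {f :: nat \<Rightarrow> nat. P (map f [0..<b])}"
proof -
  have "open (\<Inter>i<b. (\<lambda>f :: nat \<Rightarrow> nat. f i) -` {h i})" for h
    by (intro open_INT ballI open_vimage continuous_on_product_coordinates open_discrete) simp
  then have "open (\<Union>h\<in>{h. P (map h [0..<b])}. \<Inter>i<b. (\<lambda>f :: nat \<Rightarrow> nat. f i) -` {h i})"
    by blast
  also have "(\<Union>h\<in>{h. P (map h [0..<b])}. \<Inter>i<b. (\<lambda>f :: nat \<Rightarrow> nat. f i) -` {h i})
      = {f. P (map f [0..<b])}"
  proof (intro equalityI subsetI)
    fix f assume "f \<in> (\<Union>h\<in>{h. P (map h [0..<b])}. \<Inter>i<b. (\<lambda>f :: nat \<Rightarrow> nat. f i) -` {h i})"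
    then obtain h where h: "P (map h [0..<b])" "\<forall>i<b. f i = h i"
      by blast
    then have "map f [0..<b] = map h [0..<b]"
      by simp
    with h(1) show "f \<in> {f. P (map f [0..<b])}"
      by (metis mem_Collect_eq)
  qed blast
  finally show ?thesis .
qed

lemma continuous_map_segment_points:
  "continuous_map euclidean inf_sets_topology (\<lambda>f. to_nat ` segment_points f)"
proof -
  have "continuous_on UNIV (\<lambda>f. n \<in> to_nat ` segment_points f)" for n
  proof (cases "n \<in> range (to_nat :: nat \<times> nat list list \<Rightarrow> nat)")
    case True
    then obtain b :: nat and S :: "nat list list" where n: "n = to_nat (b, S)"
      by auto
    define P where "P l \<longleftrightarrow> takeWhile (\<lambda>x. x < b) l \<in> set S \<and>
      (\<forall>s\<in>set S. length S \<le> length s \<and> length s \<le> b \<and> set s \<subseteq> {..<b})" for l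
    have eq: "n \<in> to_nat ` segment_points f \<longleftrightarrow> P (map f [0..<b])" for f
      by (auto simp: n segment_points_def P_def bounded_segment_def inj_image_mem_iff)
    have "open ((\<lambda>f. P (map f [0..<b])) -` B)" for B
      using open_Collect_initial_segment[of "\<lambda>l. P l \<in> B" b] by (simp add: vimage_def)
    then show ?thesis
      unfolding eq by (simp add: continuous_on_open_vimage)
  next
    case False
    then have "n \<notin> to_nat ` segment_points f" for f
      by blast
    then show ?thesis by simp
  qed
  then have "continuous_on UNIV (\<lambda>f n. n \<in> to_nat ` segment_points f)"
    by (intro continuous_on_coordinatewise_then_product)
  moreover have "infinite (to_nat ` segment_points f)" for f
    using infinite_Inter_segment_points[of "{f}"] by (simp add: finite_image_iff)
  ultimately show ?thesis
    unfolding inf_sets_topology_def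
    by (intro continuous_map_pullback') (auto simp: comp_def)
qed

lemma centered_segment_points: "centered (range (\<lambda>f. to_nat ` segment_points f))"
  unfolding centered_def
proof (intro conjI allI impI)
  have "infinite (to_nat ` segment_points f)" for f
    using infinite_Inter_segment_points[of "{f}"] by (simp add: finite_image_iff)
  then show "range (\<lambda>f. to_nat ` segment_points f) \<subseteq> {A. infinite A}"
    by blast
next
  fix \<G> assume "\<G> \<subseteq> range (\<lambda>f. to_nat ` segment_points f)" "finite \<G>"
  then obtain F where F: "finite F" "\<G> = (\<lambda>f. to_nat ` segment_points f) ` F"
    by (meson finite_subset_image)
  have "to_nat ` (\<Inter>f\<in>F. segment_points f) \<subseteq> \<Inter>\<G>"
    unfolding F by blast
  moreover have "infinite (to_nat ` (\<Inter>f\<in>F. segment_points f))"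
    using infinite_Inter_segment_points[OF F(1)] by (simp add: finite_image_iff)
  ultimately show "infinite (\<Inter>\<G>)"
    using finite_subset by blast
qed

theorem theorem3p1:
  shows "\<exists>(\<psi> :: (nat \<Rightarrow> nat) \<Rightarrow> nat set) (\<phi> :: nat set \<Rightarrow> (nat \<Rightarrow> nat)).
    continuous_map euclidean inf_sets_topology \<psi> \<and>
    \<phi> \<in> borel_measurable (borel_of_topology inf_sets_topology) \<and>
    centered (range \<psi>) \<and>
    (\<forall>A f. infinite A \<longrightarrow> A \<subseteq>\<^sup>* \<psi> f \<longrightarrow> f \<le>\<^sup>* \<phi> A)"
proof (intro exI conjI allI impI)
  let ?\<psi> = "\<lambda>f. to_nat ` segment_points f"
  let ?\<phi> = "\<lambda>A n. iterated_bound (omission_bound (to_nat -` A)) n (Suc n)"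
  show "continuous_map euclidean inf_sets_topology ?\<psi>"
    by (rule continuous_map_segment_points)
  show "centered (range ?\<psi>)"
    by (rule centered_segment_points)
  show "?\<phi> \<in> borel_measurable (borel_of_topology inf_sets_topology)"
  proof (rule measurable_coordinatewise_then_product)
    fix n
    show "(\<lambda>A. ?\<phi> A n) \<in> borel_measurable (borel_of_topology inf_sets_topology)"
      unfolding borel_measurable_eq_count_space
      by (intro measurable_iterated_bound measurable_omission_bound)
  qed
  fix A f
  assume A: "infinite A" "A \<subseteq>\<^sup>* ?\<psi> f"
  have fin: "finite (A - ?\<psi> f)"
    using A(2) by (simp add: almost_subset_def)
  \<comment> \<open>Elements of \<open>A\<close> that code no point lie in the finite set
    \<open>A - ?\<psi> f\<close>, so infinitely many codes remain.\<close>
  have "A \<subseteq> (A - ?\<psi> f) \<union> to_nat ` (to_nat -` A :: (nat \<times> nat list list) set)"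
    by blast
  then have "infinite (to_nat -` A :: (nat \<times> nat list list) set)"
    using A(1) fin by (meson finite_Un finite_imageI finite_subset)
  moreover have "finite (to_nat -` A - segment_points f)"
  proof (rule finite_subset)
    show "to_nat -` A - segment_points f \<subseteq> to_nat -` (A - ?\<psi> f)"
      by (auto simp: inj_image_mem_iff)
    show "finite (to_nat -` (A - ?\<psi> f) :: (nat \<times> nat list list) set)"
      using fin by (rule finite_vimageI) simp
  qed
  ultimately show "f \<le>\<^sup>* ?\<phi> A"
    unfolding almost_le_def cofinite_eq_sequentially
    by (intro iterated_bound_dominates eventually_less_omission_bound)
qed

end
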